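(* Let $m\in\mathbb{N}$ and $P\subseteq H_m$. Then $P$ is piecewise syndetic if and only if there is a thick $T\subseteq H_m$ with $P\in\mathrm{Dest}(T)$, where $\mathrm{Dest}(T)=\{Q\subseteq H_m: T\setminus Q\text{ is not thick}\}$.
   Context: Let $L$ be a relational language and $\mathbf{K}$ a Fraïssé structure, i.e. a countably infinite $L$-structure that is ultrahomogeneous (every isomorphism between finite substructures of $\mathbf{K}$ extends to an automorphism of $\mathbf{K}$). Let $G=\mathrm{Aut}(\mathbf{K})$. Fix an exhaustion $\mathbf{K}=\bigcup_n\mathbf{A}_n$ by finite substructures with $\mathbf{A}_m\subseteq\mathbf{A}_n$ for $m\le n$, and let $H_n=\mathrm{Emb}(\mathbf{A}_n,\mathbf{K})$ be the set of embeddings of $\mathbf{A}_n$ into $\mathbf{K}$. $G$ acts on the right on $2^{H_m}$ (product topology) by $(\chi_A\cdot g)(f)=\chi_A(g\circ f)$ for $A\subseteq H_m$, $g\in G$, $f\in H_m$. A set $T\subseteq H_m$ is thick if $\chi_{H_m}\in\overline{\chi_T\cdot G}$; $S\subseteq H_m$ is syndetic if $\chi_\emptyset\notin\overline{\chi_S\cdot G}$; $P\subseteq H_m$ is piecewise syndetic if there is a syndetic $S\subseteq H_m$ with $\chi_S\in\overline{\chi_P\cdot G}$. *)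

theory Defs
  imports "HOL-Analysis.Analysis"
begin

section \<open>Relational structures\<close>

record 'r language =
  symbols :: "'r set"
  arity :: "'r \<Rightarrow> nat"

record ('a, 'r) struct =
  universe :: "'a set"
  interp :: "'r \<Rightarrow> 'a list set"

text \<open>An n-ary relation is a set of lists of length n. The value of \<open>interp\<close> outside the
  symbols of the language is irrelevant.\<close>

definition is_structure :: "'r language \<Rightarrow> ('a, 'r) struct \<Rightarrow> bool" where
  "is_structure L M \<longleftrightarrow>
     (\<forall>R\<in>symbols L. interp M R \<subseteq> {xs. length xs = arity L R \<and> set xs \<subseteq> universe M})"

definition substructure :: "'r language \<Rightarrow> ('a, 'r) struct \<Rightarrow> ('a, 'r) struct \<Rightarrow> bool" where
  "substructure L M N \<longleftrightarrow>
     universe M \<subseteq> universe N \<and>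
     (\<forall>R\<in>symbols L. interp M R = interp N R \<inter> lists (universe M))"

text \<open>Maps are taken in \<open>\<rightarrow>\<^sub>E\<close>, i.e. with the fixed value \<open>undefined\<close> outside their domain, so that
  equality of HOL functions is equality of maps.\<close>

definition Emb :: "'r language \<Rightarrow> ('a, 'r) struct \<Rightarrow> ('b, 'r) struct \<Rightarrow> ('a \<Rightarrow> 'b) set" where
  "Emb L M N = {f \<in> universe M \<rightarrow>\<^sub>E universe N. inj_on f (universe M) \<and>
     (\<forall>R\<in>symbols L. \<forall>xs. length xs = arity L R \<and> set xs \<subseteq> universe M \<longrightarrow>
        (xs \<in> interp M R \<longleftrightarrow> map f xs \<in> interp N R))}"

definition Iso :: "'r language \<Rightarrow> ('a, 'r) struct \<Rightarrow> ('b, 'r) struct \<Rightarrow> ('a \<Rightarrow> 'b) set" where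
  "Iso L M N = {f \<in> Emb L M N. f ` universe M = universe N}"

definition Aut :: "'r language \<Rightarrow> ('a, 'r) struct \<Rightarrow> ('a \<Rightarrow> 'a) set" where
  "Aut L M = Iso L M M"

definition ultrahomogeneous :: "'r language \<Rightarrow> ('a, 'r) struct \<Rightarrow> bool" where
  "ultrahomogeneous L K \<longleftrightarrow>
     (\<forall>M N f. substructure L M K \<and> finite (universe M) \<and>
              substructure L N K \<and> finite (universe N) \<and> f \<in> Iso L M N \<longrightarrow>
        (\<exists>g\<in>Aut L K. \<forall>x\<in>universe M. g x = f x))"

definition fraisse_structure :: "'r language \<Rightarrow> ('a, 'r) struct \<Rightarrow> bool" where
  "fraisse_structure L K \<longleftrightarrow>
     is_structure L K \<and> countable (universe K) \<and> infinite (universe K) \<and> ultrahomogeneous L K"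

definition exhaustion ::
  "'r language \<Rightarrow> ('a, 'r) struct \<Rightarrow> (nat \<Rightarrow> ('a, 'r) struct) \<Rightarrow> bool" where
  "exhaustion L K A \<longleftrightarrow>
     (\<forall>n. substructure L (A n) K \<and> finite (universe (A n))) \<and>
     (\<forall>m n. m \<le> n \<longrightarrow> substructure L (A m) (A n)) \<and>
     (\<Union>n. universe (A n)) = universe K"

section \<open>The action on subsets of Emb(A, K)\<close>

definition two_power :: "'h set \<Rightarrow> ('h \<Rightarrow> bool) topology" where
  "two_power H = product_topology (\<lambda>_. discrete_topology UNIV) H"

definition chi :: "'h set \<Rightarrow> 'h set \<Rightarrow> 'h \<Rightarrow> bool" where
  "chi H S = (\<lambda>f\<in>H. f \<in> S)"

definition act :: "'r language \<Rightarrow> ('a, 'r) struct \<Rightarrow> ('a, 'r) struct \<Rightarrow>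
    (('a \<Rightarrow> 'a) \<Rightarrow> bool) \<Rightarrow> ('a \<Rightarrow> 'a) \<Rightarrow> ('a \<Rightarrow> 'a) \<Rightarrow> bool" where
  "act L A K x g = (\<lambda>f\<in>Emb L A K. x (compose (universe A) g f))"

definition orbit_closure :: "'r language \<Rightarrow> ('a, 'r) struct \<Rightarrow> ('a, 'r) struct \<Rightarrow>
    (('a \<Rightarrow> 'a) \<Rightarrow> bool) \<Rightarrow> (('a \<Rightarrow> 'a) \<Rightarrow> bool) set" where
  "orbit_closure L A K x = two_power (Emb L A K) closure_of (act L A K x ` Aut L K)"

definition thick ::
  "'r language \<Rightarrow> ('a, 'r) struct \<Rightarrow> ('a, 'r) struct \<Rightarrow> ('a \<Rightarrow> 'a) set \<Rightarrow> bool" where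
  "thick L A K T \<longleftrightarrow> T \<subseteq> Emb L A K \<and>
     chi (Emb L A K) (Emb L A K) \<in> orbit_closure L A K (chi (Emb L A K) T)"

definition syndetic ::
  "'r language \<Rightarrow> ('a, 'r) struct \<Rightarrow> ('a, 'r) struct \<Rightarrow> ('a \<Rightarrow> 'a) set \<Rightarrow> bool" where
  "syndetic L A K S \<longleftrightarrow> S \<subseteq> Emb L A K \<and>
     chi (Emb L A K) {} \<notin> orbit_closure L A K (chi (Emb L A K) S)"

definition piecewise_syndetic ::
  "'r language \<Rightarrow> ('a, 'r) struct \<Rightarrow> ('a, 'r) struct \<Rightarrow> ('a \<Rightarrow> 'a) set \<Rightarrow> bool" where
  "piecewise_syndetic L A K P \<longleftrightarrow> P \<subseteq> Emb L A K \<and>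
     (\<exists>S. syndetic L A K S \<and>
          chi (Emb L A K) S \<in> orbit_closure L A K (chi (Emb L A K) P))"

definition Dest ::
  "'r language \<Rightarrow> ('a, 'r) struct \<Rightarrow> ('a, 'r) struct \<Rightarrow> ('a \<Rightarrow> 'a) set \<Rightarrow> ('a \<Rightarrow> 'a) set set" where
  "Dest L A K T = {Q. Q \<subseteq> Emb L A K \<and> \<not> thick L A K (T - Q)}"

end

theory Submission
  imports Defs
begin

text \<open>
  Write \<open>H\<close> for the set of embeddings, let automorphisms act on \<open>H\<close> by composition, and write
  \<open>g\<inverse>X\<close> for the set of \<open>f\<close> with \<open>g f \<in> X\<close>. Unwinding the product topology, \<open>S\<close> lies in the orbit
  closure of \<open>P\<close> iff on every finite window \<open>W \<subseteq> H\<close> some \<open>g\<inverse>P\<close> agrees with \<open>S\<close>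
  (\<open>chi_in_orbit_closure\<close>). Thus \<open>T\<close> is thick iff it contains a translate of every finite window,
  and \<open>S\<close> is syndetic iff some finite \<open>F\<close> has all its translates meeting \<open>S\<close>.

  The interesting direction is to find \<open>T\<close> for a piecewise syndetic \<open>P\<close>. Some syndetic \<open>S\<close> is
  reproduced by \<open>P\<close> on translates \<open>g W\<close> of all windows, so the union of those translates is thick.
  Removing \<open>P\<close> from it may nevertheless leave a thick set, because copies of \<open>S\<close> in different
  \<open>g W\<close> need not fit together. The remedy is to replace \<open>S\<close> by a set \<open>Z\<close> that
  still meets all translates of \<open>F\<close> and such that for each window a single \<open>g\<close> makes both
  \<open>g\<inverse>P\<close> and \<open>g\<inverse>Z\<close> agree with \<open>Z\<close> on it. Then \<open>P\<close> and \<open>Z\<close> agree with one another on \<open>g W\<close>, so the set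
  \<open>T\<close> of all points at which \<open>P\<close> and \<open>Z\<close> agree is thick, while \<open>T - P\<close> is disjoint from the
  syndetic set \<open>Z\<close> and hence is not thick.

  Such a \<open>Z\<close> is provided by the argument of Auslander and Ellis for proximal points
  (\<open>proximal_limit\<close>). In the enveloping semigroup, the closure of the maps \<open>X \<mapsto> g\<inverse>X\<close> in the compact
  space of all self-maps of the power set, the maps sending \<open>P\<close> to a set met by all translates of
  \<open>F\<close> form a nonempty closed subsemigroup. It contains an idempotent \<open>u\<close> by the Ellis-Numakura lemma
  (\<open>ellis_numakura_idempotent\<close>), and \<open>Z = u P\<close> satisfies \<open>u Z = Z\<close>; approximating \<open>u\<close> at \<open>P\<close> and \<open>Z\<close>
  simultaneously yields the required \<open>g\<close>.

  Conversely, if \<open>T\<close> is thick, some \<open>p\<close> in the enveloping semigroup maps \<open>T\<close> to \<open>H\<close>. If \<open>F\<close> has no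
  translate inside \<open>T - P\<close>, then all translates of \<open>F\<close> meet \<open>p P\<close>, so \<open>p P\<close> is a syndetic limit of \<open>P\<close>.
\<close>

section \<open>Idempotents in compact semigroups\<close>

text \<open>
  The Ellis-Numakura lemma. Let \<open>D\<close> be a minimal closed subsemigroup and \<open>u \<in> D\<close>. The right ideal \<open>u D\<close> is
  a closed subsemigroup, so \<open>u D = D\<close> contains \<open>u\<close>. The set of \<open>q \<in> D\<close> with \<open>u q = u\<close> is therefore
  nonempty; it is a closed subsemigroup too, so it is all of \<open>D\<close> and \<open>u u = u\<close>.
  Continuity is assumed in the second argument only, which is what enveloping semigroups provide.
  The last hypothesis is the part of the Hausdorff property that the argument uses.
\<close>

lemma ellis_numakura_idempotent:
  fixes m :: "'a::topological_space \<Rightarrow> 'a \<Rightarrow> 'a"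
  assumes comp: "compact C" and ne: "C \<noteq> {}"
    and mult: "\<And>p q. p \<in> C \<Longrightarrow> q \<in> C \<Longrightarrow> m p q \<in> C"
    and assoc: "\<And>p q r. m (m p q) r = m p (m q r)"
    and cont: "\<And>p. p \<in> C \<Longrightarrow> continuous_on UNIV (m p)"
    and kc: "\<And>S :: 'a set. compact S \<Longrightarrow> closed S"
  shows "\<exists>u\<in>C. m u u = u"
proof -
  define ok where "ok D \<longleftrightarrow> D \<subseteq> C \<and> D \<noteq> {} \<and> closed D \<and> (\<forall>p\<in>D. \<forall>q\<in>D. m p q \<in> D)" for D
  have okC: "ok C"
    using ne mult kc[OF comp] by (auto simp: ok_def)
  (* Minimal closed subsemigroups come from Zorn's lemma for increasing unions, applied to complements. *)
  have "\<exists>U\<in>uminus ` Collect ok. \<forall>X\<in>uminus ` Collect ok. U \<subseteq> X \<longrightarrow> X = U"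
  proof (rule subset_Zorn_nonempty)
    show "uminus ` Collect ok \<noteq> {}"
      using okC by auto
  next
    fix \<C> assume \<C>: "\<C> \<noteq> {}" and chain: "subset.chain (uminus ` Collect ok) \<C>"
    have ok: "ok (- U)" if "U \<in> \<C>" for U
      using chain that by (auto simp: subset_chain_def)
    have "C \<inter> \<Inter>(uminus ` \<C>) \<noteq> {}"
    proof (rule compact_imp_fip_image[OF comp])
      show "closed (- U)" if "U \<in> \<C>" for U
        using ok[OF that] by (simp add: ok_def)
    next
      fix \<F> assume \<F>: "finite \<F>" "\<F> \<subseteq> \<C>"
      show "C \<inter> \<Inter>(uminus ` \<F>) \<noteq> {}"
      proof (cases "\<F> = {}")
        case True
        then show ?thesis using ne by simp
      next
        case False
        have "subset.chain (uminus ` Collect ok) \<F>"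
          using chain \<F>(2) unfolding subset_chain_def by (meson subset_iff)
        then have "\<Union>\<F> \<in> \<F>"
          using Union_in_chain \<F>(1) False by blast
        then have "ok (- \<Union>\<F>)"
          using ok \<F>(2) by blast
        then have "- \<Union>\<F> \<subseteq> C" "- \<Union>\<F> \<noteq> {}"
          by (simp_all add: ok_def)
        moreover have "\<Inter>(uminus ` \<F>) = - \<Union>\<F>"
          by auto
        ultimately show ?thesis by auto
      qed
    qed
    then have "- \<Union>\<C> \<noteq> {}"
      by auto
    moreover have "- \<Union>\<C> \<subseteq> C"
    proof -
      obtain U where "U \<in> \<C>"
        using \<C> by auto
      then have "- U \<subseteq> C"
        using ok by (simp add: ok_def)
      then show ?thesis
        using \<open>U \<in> \<C>\<close> by auto
    qed
    moreover have "closed (- \<Union>\<C>)"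
      using ok unfolding ok_def closed_def by (simp add: open_Union)
    moreover have "m p q \<in> - \<Union>\<C>" if "p \<in> - \<Union>\<C>" "q \<in> - \<Union>\<C>" for p q
    proof -
      have "m p q \<in> - U" if "U \<in> \<C>" for U
      proof -
        have "p \<in> - U" "q \<in> - U"
          using \<open>p \<in> - \<Union>\<C>\<close> \<open>q \<in> - \<Union>\<C>\<close> that by auto
        then show ?thesis
          using ok[OF that] unfolding ok_def by blast
      qed
      then show ?thesis by blast
    qed
    ultimately have "ok (- \<Union>\<C>)"
      by (simp add: ok_def)
    then show "\<Union>\<C> \<in> uminus ` Collect ok"
      by (metis double_complement image_eqI mem_Collect_eq)
  qed
  then obtain D where D: "ok D" and min: "\<And>D'. ok D' \<Longrightarrow> D' \<subseteq> D \<Longrightarrow> D' = D"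
    by auto
  have "compact D"
    using D comp compact_Int_closed[of C D] by (simp add: ok_def inf.absorb2)
  obtain u where u: "u \<in> D"
    using D by (auto simp: ok_def)
  then have contu: "continuous_on UNIV (m u)"
    using cont D by (auto simp: ok_def)
  have "ok (m u ` D)"
  proof -
    have "closed (m u ` D)"
      using compact_continuous_image[OF continuous_on_subset[OF contu] \<open>compact D\<close>] kc by simp
    moreover have "m p q \<in> m u ` D" if pq: "p \<in> m u ` D" "q \<in> m u ` D" for p q
    proof -
      obtain p' q' where "p = m u p'" "p' \<in> D" "q = m u q'" "q' \<in> D"
        using pq by auto
      then have "m p q = m u (m p' (m u q'))" "m p' (m u q') \<in> D"
        using D u assoc by (auto simp: ok_def)
      then show ?thesis by blast
    qed
    moreover have "m u ` D \<subseteq> C"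
      using D u unfolding ok_def by blast
    ultimately show ?thesis
      using u by (auto simp: ok_def)
  qed
  moreover have "m u ` D \<subseteq> D"
    using D u unfolding ok_def by blast
  ultimately have "m u ` D = D"
    by (rule min)
  then obtain e where e: "e \<in> D" "m u e = u"
    using u by (metis imageE)
  let ?R = "{q \<in> D. m u q = u}"
  have "ok ?R"
  proof -
    have "closed (m u -` {u})"
      by (intro closed_vimage contu kc) simp
    moreover have "?R = D \<inter> m u -` {u}" by auto
    ultimately have "closed ?R"
      using D by (simp add: ok_def closed_Int)
    moreover have "m u (m p q) = u" if "m u p = u" "m u q = u" for p q
      using that by (simp flip: assoc)
    ultimately show ?thesis
      using D e by (auto simp: ok_def)
  qed
  then have "?R = D"
    by (rule min) auto
  then show ?thesis
    using u D by (auto simp: ok_def)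
qed

section \<open>The space of self-maps of a power set\<close>

text \<open>
  Subsets are represented by predicates, so that the self-maps of the power set carry an iterated
  product topology of discrete two-point spaces, which is compact by Tychonoff's theorem, and Hausdorff.
\<close>
lemma compact_iff_closed_bool_functions:
  fixes S :: "('x \<Rightarrow> 'h \<Rightarrow> bool) set"
  shows "compact S \<longleftrightarrow> closed S"
proof -
  have c0: "compact_space (euclidean :: bool topology)"
    by (simp add: compact_space_def finite_imp_compact)
  have h0: "Hausdorff_space (euclidean :: bool topology)"
    unfolding Hausdorff_space_def
  proof (intro allI impI)
    fix x y :: bool
    assume "x \<in> topspace euclidean \<and> y \<in> topspace euclidean \<and> x \<noteq> y"
    then show "\<exists>U V. openin euclidean U \<and> openin euclidean V \<and> x \<in> U \<and> y \<in> V \<and> disjnt U V"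
      by (intro exI[of _ "{x}"] exI[of _ "{y}"] conjI) (auto simp: open_discrete)
  qed
  have "compact_space (product_topology (\<lambda>_::'h. euclidean :: bool topology) UNIV)"
    and "Hausdorff_space (product_topology (\<lambda>_::'h. euclidean :: bool topology) UNIV)"
    by (simp_all only: compact_space_product_topology Hausdorff_space_product_topology c0 h0) auto
  then have c1: "compact_space (euclidean :: ('h \<Rightarrow> bool) topology)"
    and h1: "Hausdorff_space (euclidean :: ('h \<Rightarrow> bool) topology)"
    by (simp_all only: euclidean_product_topology)
  have "compact_space (product_topology (\<lambda>_::'x. euclidean :: ('h \<Rightarrow> bool) topology) UNIV)"
    and "Hausdorff_space (product_topology (\<lambda>_::'x. euclidean :: ('h \<Rightarrow> bool) topology) UNIV)"
    by (simp_all only: compact_space_product_topology Hausdorff_space_product_topology c1 h1) auto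
  then have c: "compact_space (euclidean :: ('x \<Rightarrow> 'h \<Rightarrow> bool) topology)"
    and h: "Hausdorff_space (euclidean :: ('x \<Rightarrow> 'h \<Rightarrow> bool) topology)"
    by (simp_all only: euclidean_product_topology)
  show ?thesis
    using closedin_compact_space[OF c, of S] compactin_imp_closedin[OF h, of S] by auto
qed

lemma continuous_on_eval:
  "continuous_on S (\<lambda>p :: 'x \<Rightarrow> 'h \<Rightarrow> 'b::topological_space. p x f)"
proof -
  have "continuous_on UNIV (\<lambda>p :: 'x \<Rightarrow> 'h \<Rightarrow> 'b. p x f)"
    by (rule continuous_on_product_then_coordinatewise) (rule continuous_on_product_coordinates)
  then show ?thesis
    by (rule continuous_on_subset) simp
qed

lemma open_eval: "open {p :: 'x \<Rightarrow> 'h \<Rightarrow> bool. p x f \<in> B}"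
proof -
  have "open ((\<lambda>p :: 'x \<Rightarrow> 'h \<Rightarrow> bool. p x f) -` B)"
    by (intro open_vimage continuous_on_eval open_discrete)
  then show ?thesis by (simp add: vimage_def)
qed

lemma closed_eval: "closed {p :: 'x \<Rightarrow> 'h \<Rightarrow> bool. p x f \<in> B}"
proof -
  have "- {p :: 'x \<Rightarrow> 'h \<Rightarrow> bool. p x f \<in> B} = {p. p x f \<in> - B}"
    by auto
  then show ?thesis
    using open_eval[of x f "- B"] by (simp only: closed_def)
qed

section \<open>The enveloping semigroup\<close>

text \<open>
  Closure under composition is only asked for on \<open>H\<close>: composing with two automorphisms in turn is the same as
  composing with their product on embeddings, but not on maps that leave the universe.
\<close>
locale transformation_semigroup =
  fixes H :: "'h set" and G :: "('h \<Rightarrow> 'h) set"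
  assumes maps: "g \<in> G \<Longrightarrow> f \<in> H \<Longrightarrow> g f \<in> H"
    and closed_comp: "g \<in> G \<Longrightarrow> h \<in> G \<Longrightarrow> \<exists>k\<in>G. \<forall>f\<in>H. k f = g (h f)"
begin

definition pull :: "('h \<Rightarrow> 'h) \<Rightarrow> ('h \<Rightarrow> bool) \<Rightarrow> 'h \<Rightarrow> bool" where
  "pull g x = (\<lambda>f. f \<in> H \<and> x (g f))"

definition enveloping :: "(('h \<Rightarrow> bool) \<Rightarrow> 'h \<Rightarrow> bool) set" where
  "enveloping = closure (pull ` G)"

lemma closed_enveloping: "closed enveloping"
  by (simp add: enveloping_def)

lemma enveloping_approx:
  assumes p: "p \<in> enveloping" and X: "finite X" and W: "finite W" "W \<subseteq> H"
  shows "\<exists>g\<in>G. \<forall>x\<in>X. \<forall>f\<in>W. p x f \<longleftrightarrow> x (g f)"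
proof -
  define U where "U = (\<Inter>x\<in>X. \<Inter>f\<in>W. {q. q x f \<in> {p x f}})"
  have "open U"
    unfolding U_def using X W(1) by (intro open_INT ballI open_eval)
  moreover have "p \<in> U"
    by (simp add: U_def)
  moreover have "p \<in> closure (pull ` G)"
    using p by (simp only: enveloping_def)
  ultimately have "U \<inter> pull ` G \<noteq> {}"
    using open_Int_closure_eq_empty[of U "pull ` G"] by blast
  then obtain g where g: "g \<in> G" "pull g \<in> U"
    by blast
  then show ?thesis
  proof (intro bexI[of _ g] ballI)
    fix x f assume "x \<in> X" "f \<in> W"
    then have "pull g x f = p x f"
      using g(2) by (simp add: U_def)
    then show "p x f \<longleftrightarrow> x (g f)"
      using \<open>f \<in> W\<close> W(2) by (auto simp: pull_def)
  qed (rule g(1))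
qed

lemma continuous_comp_right:
  fixes p :: "'x \<Rightarrow> 'y"
  shows "continuous_on UNIV (\<lambda>q :: 'y \<Rightarrow> 'h \<Rightarrow> bool. q \<circ> p)"
  unfolding comp_def
  by (rule continuous_on_coordinatewise_then_product) (rule continuous_on_product_coordinates)

lemma continuous_pull_comp:
  "continuous_on UNIV (\<lambda>p :: 'x \<Rightarrow> 'h \<Rightarrow> bool. pull g \<circ> p)"
proof -
  have "continuous_on UNIV (\<lambda>p :: 'x \<Rightarrow> 'h \<Rightarrow> bool. f \<in> H \<and> p x (g f))" for x f
    by (cases "f \<in> H") (simp_all add: continuous_on_eval)
  then show ?thesis
    unfolding comp_def pull_def
    by (rule continuous_on_coordinatewise_then_product[OF continuous_on_coordinatewise_then_product])
qed

text \<open>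
  Composition of self-maps is continuous in the left factor for a fixed right factor, and it is
  continuous in the right factor when the left one is some \<open>pull g\<close>. The limit is therefore taken in the right factor
  first and in the left factor second.
\<close>
lemma enveloping_comp:
  assumes p: "p \<in> enveloping" and q: "q \<in> enveloping"
  shows "q \<circ> p \<in> enveloping"
proof -
  have pp: "pull h \<circ> pull g \<in> pull ` G" if gh: "g \<in> G" "h \<in> G" for g h
  proof -
    obtain k where k: "k \<in> G" "\<And>f. f \<in> H \<Longrightarrow> k f = g (h f)"
      using closed_comp[OF gh] by auto
    have "pull h \<circ> pull g = pull k"
      using maps[OF gh(2)] k(2) by (auto simp: pull_def fun_eq_iff)
    then show ?thesis using k(1) by blast
  qed
  have "pull h \<circ> p \<in> enveloping" if "h \<in> G" for h
  proof -
    have "(\<lambda>p. pull h \<circ> p) ` closure (pull ` G) \<subseteq> closure (pull ` G)"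
      using pp[OF _ that] closure_subset
      by (intro image_closure_subset continuous_on_subset[OF continuous_pull_comp]) fastforce+
    then show ?thesis
      using p unfolding enveloping_def by blast
  qed
  then have "(\<lambda>q. q \<circ> p) ` closure (pull ` G) \<subseteq> enveloping"
    using closed_enveloping
    by (intro image_closure_subset continuous_on_subset[OF continuous_comp_right]) auto
  then show ?thesis
    using q unfolding enveloping_def by blast
qed

text \<open>
  Membership of \<open>y\<close> in the orbit closure of \<open>x\<close> for pointwise convergence on \<open>H\<close>.
\<close>
definition limit_of :: "('h \<Rightarrow> bool) \<Rightarrow> ('h \<Rightarrow> bool) \<Rightarrow> bool" where
  "limit_of x y \<longleftrightarrow> (\<forall>W. finite W \<and> W \<subseteq> H \<longrightarrow> (\<exists>g\<in>G. \<forall>f\<in>W. x (g f) \<longleftrightarrow> y f))"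

text \<open>
  Compactness turns the approximations to \<open>y\<close> on finite windows, by varying translates of \<open>x\<close>, into a
  single element of the enveloping semigroup.
\<close>
lemma limit_enveloping:
  assumes "limit_of x y"
  shows "\<exists>p\<in>enveloping. \<forall>f\<in>H. p x f = y f"
proof -
  have "enveloping \<inter> (\<Inter>f\<in>H. {p. p x f \<in> {y f}}) \<noteq> {}"
  proof (rule compact_imp_fip_image)
    show "compact enveloping"
      by (simp add: compact_iff_closed_bool_functions closed_enveloping)
  next
    fix f show "closed {p. p x f \<in> {y f}}"
      by (rule closed_eval)
  next
    fix W assume W: "finite W" "W \<subseteq> H"
    then obtain g where g: "g \<in> G" "\<forall>f\<in>W. x (g f) \<longleftrightarrow> y f"
      using assms unfolding limit_of_def by blast
    have "pull g \<in> enveloping"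
      unfolding enveloping_def using g(1) by (intro subsetD[OF closure_subset] imageI)
    moreover have "pull g \<in> (\<Inter>f\<in>W. {p. p x f \<in> {y f}})"
      using g(2) W(2) by (auto simp: pull_def)
    ultimately show "enveloping \<inter> (\<Inter>f\<in>W. {p. p x f \<in> {y f}}) \<noteq> {}"
      by blast
  qed
  then show ?thesis by auto
qed

section \<open>Limits whose support meets all translates of a finite set\<close>

text \<open>
  A variant of the Auslander-Ellis theorem: the limit \<open>y\<close> of \<open>x\<close> can be exchanged for a limit \<open>z\<close> that is
  in addition proximal to \<open>x\<close>, in that the same \<open>g\<close> carry both \<open>x\<close> and \<open>z\<close> close to \<open>z\<close>. Being met by
  all translates of \<open>F\<close> is inherited by limits, so the elements of the enveloping semigroup that send \<open>x\<close>
  to such a predicate form a subsemigroup, and an idempotent of it sends \<open>x\<close> to a suitable \<open>z\<close>.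
\<close>
lemma proximal_limit:
  assumes lim: "limit_of x y" and F: "finite F" "F \<subseteq> H"
    and hits: "\<forall>g\<in>G. \<exists>f\<in>F. y (g f)"
  shows "\<exists>z. (\<forall>g\<in>G. \<exists>f\<in>F. z (g f)) \<and>
    (\<forall>W. finite W \<and> W \<subseteq> H \<longrightarrow> (\<exists>g\<in>G. \<forall>f\<in>W. (x (g f) \<longleftrightarrow> z f) \<and> (z (g f) \<longleftrightarrow> z f)))"
proof -
  define C where "C = {p \<in> enveloping. \<forall>g\<in>G. \<exists>f\<in>F. p x (g f)}"
  have "\<exists>u\<in>C. u \<circ> u = u"
  proof (rule ellis_numakura_idempotent[where m = "\<lambda>p q. q \<circ> p"])
    have "C = enveloping \<inter> (\<Inter>g\<in>G. \<Union>f\<in>F. {p. p x (g f) \<in> {True}})"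
      by (auto simp: C_def)
    moreover have "closed \<dots>"
      using F(1) by (intro closed_Int closed_enveloping closed_INT ballI closed_UN closed_eval)
    ultimately show "compact C"
      by (simp add: compact_iff_closed_bool_functions)
  next
    obtain p where "p \<in> enveloping" "\<forall>f\<in>H. p x f = y f"
      using limit_enveloping[OF lim] by blast
    moreover have "g f \<in> H" if "g \<in> G" "f \<in> F" for g f
      using that maps F(2) by blast
    ultimately have "p \<in> C"
      using hits unfolding C_def by fastforce
    then show "C \<noteq> {}" by blast
  next
    fix p q assume p: "p \<in> C" and q: "q \<in> C"
    have "\<exists>f\<in>F. q (p x) (g f)" if g: "g \<in> G" for g
    proof -
      have "finite (g ` F)" "g ` F \<subseteq> H"
        using F maps[OF g] by auto
      then obtain h where h: "h \<in> G" "\<And>f. f \<in> F \<Longrightarrow> q (p x) (g f) \<longleftrightarrow> p x (h (g f))"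
        using enveloping_approx[of q "{p x}" "g ` F"] q unfolding C_def by auto
      obtain k where k: "k \<in> G" "\<And>f. f \<in> H \<Longrightarrow> k f = h (g f)"
        using closed_comp[OF h(1) g] by auto
      obtain f where "f \<in> F" "p x (k f)"
        using p k(1) unfolding C_def by blast
      then show ?thesis
        using h(2) k(2) F(2) by (metis subsetD)
    qed
    then show "q \<circ> p \<in> C"
      using p q enveloping_comp unfolding C_def by auto
  next
    fix p :: "('h \<Rightarrow> bool) \<Rightarrow> 'h \<Rightarrow> bool"
    show "continuous_on UNIV (\<lambda>q :: ('h \<Rightarrow> bool) \<Rightarrow> 'h \<Rightarrow> bool. q \<circ> p)"
      by (rule continuous_comp_right)
  next
    fix S :: "(('h \<Rightarrow> bool) \<Rightarrow> 'h \<Rightarrow> bool) set"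
    assume "compact S" then show "closed S"
      by (simp add: compact_iff_closed_bool_functions)
  qed (simp add: comp_assoc)
  then obtain u where u: "u \<in> C" "u \<circ> u = u"
    by blast
  have idem: "u (u x) = u x"
    using u(2) by (metis comp_apply)
  have "\<exists>g\<in>G. \<forall>f\<in>W. (x (g f) \<longleftrightarrow> u x f) \<and> (u x (g f) \<longleftrightarrow> u x f)"
    if W: "finite W" "W \<subseteq> H" for W
    using enveloping_approx[of u "{x, u x}" W] u(1) W idem unfolding C_def by fastforce
  then show ?thesis
    using u(1) unfolding C_def by blast
qed

text \<open>
  For thick \<open>t\<close>, some \<open>p\<close> in the enveloping semigroup sends \<open>t\<close> to all of \<open>H\<close>. A translate of \<open>F\<close> avoiding \<open>p x\<close>
  would then be carried, by an approximation to \<open>p\<close>, to a translate of \<open>F\<close> inside \<open>t\<close> that avoids \<open>x\<close>.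
\<close>
lemma limit_meeting_translates:
  assumes full: "\<forall>W. finite W \<and> W \<subseteq> H \<longrightarrow> (\<exists>g\<in>G. \<forall>f\<in>W. t (g f))"
    and F: "finite F" "F \<subseteq> H"
    and avoid: "\<forall>g\<in>G. \<exists>f\<in>F. \<not> (t (g f) \<and> \<not> x (g f))"
  shows "\<exists>y. (\<forall>g\<in>G. \<exists>f\<in>F. y (g f)) \<and> limit_of x y"
proof -
  have "limit_of t (\<lambda>_. True)"
    using full by (auto simp: limit_of_def)
  then obtain p where p: "p \<in> enveloping" and pt: "\<And>f. f \<in> H \<Longrightarrow> p t f"
    using limit_enveloping by blast
  have "\<exists>f\<in>F. p x (g f)" if g: "g \<in> G" for g
  proof -
    have W: "finite (g ` F)" "g ` F \<subseteq> H"
      using F maps[OF g] by auto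
    then obtain h where h: "h \<in> G"
      "\<And>f. f \<in> F \<Longrightarrow> p x (g f) \<longleftrightarrow> x (h (g f))" "\<And>f. f \<in> F \<Longrightarrow> p t (g f) \<longleftrightarrow> t (h (g f))"
      using enveloping_approx[OF p, of "{x, t}" "g ` F"] by auto
    obtain k where k: "k \<in> G" "\<And>f. f \<in> H \<Longrightarrow> k f = h (g f)"
      using closed_comp[OF h(1) g] by auto
    obtain f where f: "f \<in> F" "\<not> (t (k f) \<and> \<not> x (k f))"
      using bspec[OF avoid k(1)] by blast
    have "k f = h (g f)" "g f \<in> H"
      using k(2) f(1) F(2) W(2) by auto
    then have "t (k f)"
      using h(3)[OF f(1)] pt by simp
    then show ?thesis
      using f h(2) \<open>k f = h (g f)\<close> by auto
  qed
  moreover have "limit_of x (p x)"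
    unfolding limit_of_def using enveloping_approx[OF p, of "{x}"] by fastforce
  ultimately show ?thesis by blast
qed

end

section \<open>Thick and syndetic sets of embeddings\<close>

lemma compose_Aut_Emb:
  assumes "g \<in> Aut L K" "f \<in> Emb L A K"
  shows "compose (universe A) g f \<in> Emb L A K"
proof -
  have g: "g ` universe K \<subseteq> universe K" "inj_on g (universe K)"
    and gR: "\<And>R xs. R \<in> symbols L \<Longrightarrow> length xs = arity L R \<Longrightarrow> set xs \<subseteq> universe K \<Longrightarrow>
        xs \<in> interp K R \<longleftrightarrow> map g xs \<in> interp K R"
    using assms(1) unfolding Aut_def Iso_def Emb_def by auto
  have f: "f ` universe A \<subseteq> universe K" "inj_on f (universe A)"
    and fR: "\<And>R xs. R \<in> symbols L \<Longrightarrow> length xs = arity L R \<Longrightarrow> set xs \<subseteq> universe A \<Longrightarrow>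
        xs \<in> interp A R \<longleftrightarrow> map f xs \<in> interp K R"
    using assms(2) unfolding Emb_def by auto
  have "xs \<in> interp A R \<longleftrightarrow> map (compose (universe A) g f) xs \<in> interp K R"
    if "R \<in> symbols L" "length xs = arity L R" "set xs \<subseteq> universe A" for R xs
  proof -
    have "map (compose (universe A) g f) xs = map g (map f xs)"
      using that(3) by (auto simp: compose_def)
    moreover have "set (map f xs) \<subseteq> universe K"
      using that(3) f(1) by auto
    ultimately show ?thesis
      using gR[of R "map f xs"] fR[of R xs] that by (simp del: map_map)
  qed
  moreover have "inj_on (compose (universe A) g f) (universe A)"
  proof -
    have "inj_on (g \<circ> f) (universe A)"
      using f g(2) by (blast intro: comp_inj_on inj_on_subset)
    then show ?thesis
      by (simp add: inj_on_def compose_def)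
  qed
  moreover have "compose (universe A) g f \<in> universe A \<rightarrow>\<^sub>E universe K"
    using f(1) g(1) by (auto simp: compose_def)
  ultimately show ?thesis
    unfolding Emb_def by blast
qed

lemma compose_Aut:
  assumes "g \<in> Aut L K" "h \<in> Aut L K"
  shows "compose (universe K) g h \<in> Aut L K"
proof -
  have "compose (universe K) g h ` universe K = g ` h ` universe K"
    by (auto simp: compose_def image_iff)
  then show ?thesis
    using assms compose_Aut_Emb[of g L K h K] unfolding Aut_def Iso_def by auto
qed

lemma transformation_semigroup_Emb:
  "transformation_semigroup (Emb L A K) (compose (universe A) ` Aut L K)"
proof
  fix g f assume "g \<in> compose (universe A) ` Aut L K" "f \<in> Emb L A K"
  then show "g f \<in> Emb L A K"
    using compose_Aut_Emb by blast
next
  fix g h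
  assume "g \<in> compose (universe A) ` Aut L K" "h \<in> compose (universe A) ` Aut L K"
  then obtain a b where ab: "a \<in> Aut L K" "b \<in> Aut L K"
    and gh: "g = compose (universe A) a" "h = compose (universe A) b"
    by blast
  show "\<exists>k\<in>compose (universe A) ` Aut L K. \<forall>f\<in>Emb L A K. k f = g (h f)"
  proof (intro bexI ballI)
    fix f assume "f \<in> Emb L A K"
    then have "f \<in> universe A \<rightarrow> universe K"
      by (auto simp: Emb_def)
    then show "compose (universe A) (compose (universe K) a b) f = g (h f)"
      by (simp add: gh compose_assoc)
  qed (use compose_Aut[OF ab] in blast)
qed

lemma chi_in_orbit_closure:
  "chi (Emb L A K) B \<in> orbit_closure L A K (chi (Emb L A K) C) \<longleftrightarrow>
    (\<forall>W. finite W \<and> W \<subseteq> Emb L A K \<longrightarrow>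
      (\<exists>g\<in>Aut L K. \<forall>f\<in>W. compose (universe A) g f \<in> C \<longleftrightarrow> f \<in> B))"
  (is "?b \<in> _ \<longleftrightarrow> ?rhs")
proof -
  let ?H = "Emb L A K"
  let ?orb = "act L A K (chi ?H C) ` Aut L K"
  have act: "act L A K (chi ?H C) g = (\<lambda>f\<in>?H. compose (universe A) g f \<in> C)" if "g \<in> Aut L K" for g
    using compose_Aut_Emb[OF that] by (auto simp: act_def chi_def fun_eq_iff)
  have top: "topspace (two_power ?H) = ?H \<rightarrow>\<^sub>E UNIV"
    by (simp add: two_power_def)
  have btop: "?b \<in> topspace (two_power ?H)"
    by (simp add: top chi_def)
  show ?thesis
  proof
    assume b: "?b \<in> orbit_closure L A K (chi ?H C)"
    show ?rhs
    proof (intro allI impI)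
      fix W assume W: "finite W \<and> W \<subseteq> ?H"
      let ?U = "\<lambda>f. if f \<in> W then {f \<in> B} else UNIV"
      have "{f \<in> ?H. ?U f \<noteq> UNIV} \<subseteq> W"
        by auto
      then have "finite {f \<in> ?H. ?U f \<noteq> UNIV}"
        using W finite_subset by blast
      then have "openin (two_power ?H) (Pi\<^sub>E ?H ?U)"
        unfolding two_power_def by (intro openin_PiE_gen[THEN iffD2] disjI2) auto
      moreover have "?b \<in> Pi\<^sub>E ?H ?U"
        by (auto simp: chi_def)
      ultimately obtain g where g: "g \<in> Aut L K" "act L A K (chi ?H C) g \<in> Pi\<^sub>E ?H ?U"
        using b unfolding orbit_closure_def in_closure_of by blast
      have "compose (universe A) g f \<in> C \<longleftrightarrow> f \<in> B" if "f \<in> W" for f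
        using PiE_mem[OF g(2), of f] that W unfolding act[OF g(1)] by auto
      then show "\<exists>g\<in>Aut L K. \<forall>f\<in>W. compose (universe A) g f \<in> C \<longleftrightarrow> f \<in> B"
        using g(1) by blast
    qed
  next
    assume r: ?rhs
    have "\<exists>y. y \<in> ?orb \<and> y \<in> T" if T: "?b \<in> T" "openin (two_power ?H) T" for T
    proof -
      obtain U where U: "finite {f \<in> ?H. U f \<noteq> UNIV}" "?b \<in> Pi\<^sub>E ?H U" "Pi\<^sub>E ?H U \<subseteq> T"
        using bspec[OF T(2)[unfolded two_power_def openin_product_topology_alt] T(1)] by auto
      then obtain g where g: "g \<in> Aut L K"
        "\<forall>f\<in>{f \<in> ?H. U f \<noteq> UNIV}. compose (universe A) g f \<in> C \<longleftrightarrow> f \<in> B"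
        using r by (metis (no_types, lifting) mem_Collect_eq subsetI)
      have "(compose (universe A) g f \<in> C) \<in> U f" if "f \<in> ?H" for f
      proof (cases "U f = UNIV")
        case False
        then show ?thesis
          using PiE_mem[OF U(2) that] g(2) that by (auto simp: chi_def)
      qed simp
      then have "act L A K (chi ?H C) g \<in> Pi\<^sub>E ?H U"
        by (auto simp: act[OF g(1)])
      then show ?thesis
        using g(1) U(3) by blast
    qed
    then show "?b \<in> orbit_closure L A K (chi ?H C)"
      unfolding orbit_closure_def in_closure_of using btop by blast
  qed
qed

lemma thick_iff:
  "thick L A K T \<longleftrightarrow> T \<subseteq> Emb L A K \<and>
    (\<forall>W. finite W \<and> W \<subseteq> Emb L A K \<longrightarrow> (\<exists>g\<in>Aut L K. \<forall>f\<in>W. compose (universe A) g f \<in> T))"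
  unfolding thick_def chi_in_orbit_closure by (meson subsetD)

lemma syndetic_iff:
  "syndetic L A K S \<longleftrightarrow> S \<subseteq> Emb L A K \<and>
    (\<exists>F. finite F \<and> F \<subseteq> Emb L A K \<and> (\<forall>g\<in>Aut L K. \<exists>f\<in>F. compose (universe A) g f \<in> S))"
  unfolding syndetic_def chi_in_orbit_closure by auto

section \<open>Piecewise syndetic sets\<close>

theorem theorem4p2:
  fixes L :: "'r language" and K :: "('a, 'r) struct"
    and A :: "nat \<Rightarrow> ('a, 'r) struct" and m :: nat and P :: "('a \<Rightarrow> 'a) set"
  assumes "fraisse_structure L K"
    and "exhaustion L K A"
    and "P \<subseteq> Emb L (A m) K"
  shows "piecewise_syndetic L (A m) K P \<longleftrightarrow>
    (\<exists>T. thick L (A m) K T \<and> P \<in> Dest L (A m) K T)"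
proof -
  define H where "H = Emb L (A m) K"
  define G where "G = compose (universe (A m)) ` Aut L K"
  interpret transformation_semigroup H G
    unfolding H_def G_def by (rule transformation_semigroup_Emb)
  have P: "P \<subseteq> H"
    using assms(3) by (simp add: H_def)
  have thick: "thick L (A m) K T \<longleftrightarrow>
      T \<subseteq> H \<and> (\<forall>W. finite W \<and> W \<subseteq> H \<longrightarrow> (\<exists>g\<in>G. \<forall>f\<in>W. g f \<in> T))" for T
    by (simp add: thick_iff H_def G_def)
  have synd: "syndetic L (A m) K S \<longleftrightarrow>
      S \<subseteq> H \<and> (\<exists>F. finite F \<and> F \<subseteq> H \<and> (\<forall>g\<in>G. \<exists>f\<in>F. g f \<in> S))" for S
    by (simp add: syndetic_iff H_def G_def)
  have ps: "piecewise_syndetic L (A m) K P \<longleftrightarrow>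
      (\<exists>S. syndetic L (A m) K S \<and> limit_of (\<lambda>f. f \<in> P) (\<lambda>f. f \<in> S))"
    unfolding piecewise_syndetic_def chi_in_orbit_closure limit_of_def
    using assms(3) by (simp add: H_def G_def)
  show ?thesis
  proof
    assume "piecewise_syndetic L (A m) K P"
    then obtain S F where lim: "limit_of (\<lambda>f. f \<in> P) (\<lambda>f. f \<in> S)"
      and F: "finite F" "F \<subseteq> H" "\<forall>g\<in>G. \<exists>f\<in>F. g f \<in> S"
      unfolding ps synd by blast
    obtain z where z: "\<forall>g\<in>G. \<exists>f\<in>F. z (g f)"
      and prox: "\<forall>W. finite W \<and> W \<subseteq> H \<longrightarrow>
        (\<exists>g\<in>G. \<forall>f\<in>W. (g f \<in> P \<longleftrightarrow> z f) \<and> (z (g f) \<longleftrightarrow> z f))"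
      using proximal_limit[OF lim F] by (elim exE conjE)
    define T where "T = {h \<in> H. h \<in> P \<longleftrightarrow> z h}"
    (* On g ` W both P and z are copies of z on W, so they agree there. *)
    have "thick L (A m) K T"
      unfolding thick
    proof (intro conjI allI impI)
      fix W assume W: "finite W \<and> W \<subseteq> H"
      then obtain g where g: "g \<in> G" "\<forall>f\<in>W. (g f \<in> P \<longleftrightarrow> z f) \<and> (z (g f) \<longleftrightarrow> z f)"
        using prox W by (elim allE[of _ W]) blast
      then have "\<forall>f\<in>W. g f \<in> T"
        using W maps by (auto simp: T_def)
      then show "\<exists>g\<in>G. \<forall>f\<in>W. g f \<in> T"
        using g(1) by blast
    qed (auto simp: T_def)
    (* T - P lies outside z, which every translate of F meets. *)
    moreover have "\<not> thick L (A m) K (T - P)"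
    proof
      assume "thick L (A m) K (T - P)"
      then have "\<forall>W. finite W \<and> W \<subseteq> H \<longrightarrow> (\<exists>g\<in>G. \<forall>f\<in>W. g f \<in> T - P)"
        unfolding thick by (elim conjE)
      then have "\<exists>g\<in>G. \<forall>f\<in>F. g f \<in> T - P"
        using F(1,2) by (elim allE[of _ F]) simp
      then obtain g where g: "g \<in> G" "\<forall>f\<in>F. g f \<in> T - P"
        by (elim bexE)
      then show False
        using bspec[OF z g(1)] g(2) by (auto simp: T_def)
    qed
    ultimately show "\<exists>T. thick L (A m) K T \<and> P \<in> Dest L (A m) K T"
      using assms(3) unfolding Dest_def by blast
  next
    assume "\<exists>T. thick L (A m) K T \<and> P \<in> Dest L (A m) K T"
    then obtain T where T: "thick L (A m) K T" and TP: "\<not> thick L (A m) K (T - P)"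
      unfolding Dest_def by blast
    have TH: "T \<subseteq> H" and full: "\<forall>W. finite W \<and> W \<subseteq> H \<longrightarrow> (\<exists>g\<in>G. \<forall>f\<in>W. g f \<in> T)"
      using T[unfolded thick] by - (elim conjE, assumption)+
    have "T - P \<subseteq> H"
      using TH by auto
    then have "\<exists>F. finite F \<and> F \<subseteq> H \<and> \<not> (\<exists>g\<in>G. \<forall>f\<in>F. g f \<in> T - P)"
      using TP by (simp only: thick not_all not_imp conj_assoc simp_thms)
    then obtain F where F: "finite F" "F \<subseteq> H" "\<forall>g\<in>G. \<exists>f\<in>F. \<not> (g f \<in> T \<and> g f \<notin> P)"
      by auto
    obtain y where y: "\<forall>g\<in>G. \<exists>f\<in>F. y (g f)" and lim: "limit_of (\<lambda>f. f \<in> P) y"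
      using limit_meeting_translates[OF full F] by (elim exE conjE)
    let ?S = "{f \<in> H. y f}"
    have "syndetic L (A m) K ?S"
      unfolding synd
    proof (intro conjI exI[of _ F] ballI)
      fix g assume "g \<in> G"
      then show "\<exists>f\<in>F. g f \<in> ?S"
        using y maps F(2) by blast
    qed (use F in auto)
    moreover have "limit_of (\<lambda>f. f \<in> P) (\<lambda>f. f \<in> ?S)"
      unfolding limit_of_def
    proof (intro allI impI)
      fix W assume W: "finite W \<and> W \<subseteq> H"
      then obtain g where g: "g \<in> G" "\<forall>f\<in>W. g f \<in> P \<longleftrightarrow> y f"
        using lim unfolding limit_of_def by (elim allE[of _ W]) auto
      moreover have "\<forall>f\<in>W. f \<in> ?S \<longleftrightarrow> y f"
        using W by auto
      ultimately show "\<exists>g\<in>G. \<forall>f\<in>W. g f \<in> P \<longleftrightarrow> f \<in> ?S"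
        by (intro bexI[of _ g]) simp_all
    qed
    ultimately show "piecewise_syndetic L (A m) K P"
      unfolding ps by blast
  qed
qed

end
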